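(* Suppose $\mathcal Z$ and $\mathcal U$ are compact and contain the origin, $(A,B)$ is controllable and $(A,C)$, $(A,H)$ are observable, and the simulated ROM trajectory satisfies $\bar u_k\in\mathcal U$ and $H\bar x_k\in\mathcal Z$ for all $k\ge\underline k$. Then the set $\bar{\mathcal X}$ defined in the context is compact (every $b_{\bar x,l}$ is finite) and $\bar x_k\in\bar{\mathcal X}$ for all $k\ge\underline k$.
   Context: $A\in\mathbb R^{n\times n}$, $B\in\mathbb R^{n\times m}$, $C\in\mathbb R^{p\times n}$, $H\in\mathbb R^{o\times n}$. Polytopes $\mathcal Z=\{z:H_zz\le b_z\}\subset\mathbb R^o$ and $\mathcal U=\{u:H_uu\le b_u\}\subset\mathbb R^m$. The simulated ROM is $\bar x_{k+1}=A\bar x_k+B\bar u_k$ for all $k\ge\underline k$. Fix an integer $\bar i\ge n-1$. Let $H_{\bar x}=[I,\,-I]^T\in\mathbb R^{2n\times n}$ with rows $h_{\bar x,l}^T$, $l=1,\dots,2n$. Define $b_{\bar x,l}$ as the optimal value of the linear program: maximize $h_{\bar x,l}^T\bar x_0$ over $\bar x_0,\dots,\bar x_{\bar i}$ and $\bar u_0,\dots,\bar u_{\bar i-1}$ subject to $\bar x_{i+1}=A\bar x_i+B\bar u_i$, $\bar u_i\in\mathcal U$ for $i=0,\dots,\bar i-1$, and $H\bar x_i\in\mathcal Z$ for $i=0,\dots,\bar i$. Define $\bar{\mathcal X}=\{\bar x:H_{\bar x}\bar x\le b_{\bar x}\}$. *)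

theory Defs
  imports "HOL-Analysis.Analysis"
begin

(* Matrix power A^k for square matrices *)
primrec mpow :: "real^'n^'n \<Rightarrow> nat \<Rightarrow> real^'n^'n" where
  "mpow A 0 = mat 1"
| "mpow A (Suc k) = A ** mpow A k"

(* Polytope {z. Hp z \<le> bp} (componentwise inequality) *)
definition polytope_hrep :: "real^'d^'q \<Rightarrow> real^'q \<Rightarrow> (real^'d) set" where
  "polytope_hrep Hp bp = {z. Hp *v z \<le> bp}"

(* Kalman rank condition: rank [B, AB, ..., A^(n-1) B] = n, i.e. the columns of
   the controllability matrix span a space of dimension n *)
definition controllable :: "real^'n^'n \<Rightarrow> real^'m^'n \<Rightarrow> bool" where
  "controllable A B \<longleftrightarrow>
     dim (\<Union>k\<in>{..<CARD('n)}. columns (mpow A k ** B)) = CARD('n)"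

(* Observability rank condition: rank [C; CA; ...; CA^(n-1)] = n *)
definition observable :: "real^'n^'n \<Rightarrow> real^'n^'p \<Rightarrow> bool" where
  "observable A C \<longleftrightarrow>
     dim (\<Union>k\<in>{..<CARD('n)}. rows (C ** mpow A k)) = CARD('n)"

(* Feasible initial states of the LP: x0 such that there is a trajectory
   x_0..x_ibar, u_0..u_(ibar-1) with the ROM dynamics, u_i \<in> U, H x_i \<in> Z *)
definition lp_feasible ::
  "real^'n^'n \<Rightarrow> real^'m^'n \<Rightarrow> real^'n^'o \<Rightarrow> (real^'o) set \<Rightarrow> (real^'m) set \<Rightarrow> nat
     \<Rightarrow> (real^'n) set" where
  "lp_feasible A B H Z U ibar =
     {x0. \<exists>xs us. xs 0 = x0
        \<and> (\<forall>i<ibar. xs (Suc i) = A *v xs i + B *v us i \<and> us i \<in> U)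
        \<and> (\<forall>i\<le>ibar. H *v xs i \<in> Z)}"

(* Rows of H_xbar = [I; -I]: row l (l = 1..n) is e_l, row n+l is -e_l.
   We index them by Inl i / Inr i. *)
definition hxbar_row :: "'n + 'n \<Rightarrow> real^'n" where
  "hxbar_row l = (case l of Inl i \<Rightarrow> axis i 1 | Inr i \<Rightarrow> - axis i 1)"

(* b_{xbar,l}: optimal value of the LP maximizing h_l^T xbar_0 over the feasible set *)
definition bxbar ::
  "real^'n^'n \<Rightarrow> real^'m^'n \<Rightarrow> real^'n^'o \<Rightarrow> (real^'o) set \<Rightarrow> (real^'m) set \<Rightarrow> nat
     \<Rightarrow> 'n + 'n \<Rightarrow> real" where
  "bxbar A B H Z U ibar l = Sup ((\<lambda>x0. hxbar_row l \<bullet> x0) ` lp_feasible A B H Z U ibar)"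

definition Xbar ::
  "real^'n^'n \<Rightarrow> real^'m^'n \<Rightarrow> real^'n^'o \<Rightarrow> (real^'o) set \<Rightarrow> (real^'m) set \<Rightarrow> nat
     \<Rightarrow> (real^'n) set" where
  "Xbar A B H Z U ibar = {x. \<forall>l. hxbar_row l \<bullet> x \<le> bxbar A B H Z U ibar l}"

end

theory Submission
  imports Defs
begin

text \<open>Along a feasible trajectory \<open>H A\<^sup>k x\<^sub>0 = H x\<^sub>k - H (x\<^sub>k - A\<^sup>k x\<^sub>0)\<close>, where
  \<open>H x\<^sub>k \<in> \<Z>\<close> and the forced response \<open>x\<^sub>k - A\<^sup>k x\<^sub>0\<close> is driven by inputs from the
  bounded set \<open>\<U>\<close>. So for \<open>k < n \<le> ibar + 1\<close> the outputs \<open>H A\<^sup>k x\<^sub>0\<close> stay bounded over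
  all feasible initial states, and observability of \<open>(A, H)\<close> makes \<open>x\<^sub>0\<close> itself bounded.
  Hence every LP is bounded; it is feasible because the simulated trajectory started at any
  \<open>k \<ge> k\<^sub>0\<close> is a feasible point, which also puts \<open>x\<^sub>k\<close> below every optimal value.
  Finally \<open>Xbar\<close> is a box, whatever the right-hand sides \<open>b\<close> are.\<close>

lemma matrix_row_inner: "(M::real^'n^'m) $ q \<bullet> x = (M *v x) $ q"
  by (simp add: matrix_vector_mult_def inner_vec_def mult.commute)

lemma bounded_inner_span:
  fixes F :: "'a::real_inner set"
  assumes "v \<in> span S" and "\<And>s. s \<in> S \<Longrightarrow> \<exists>C. \<forall>x\<in>F. \<bar>s \<bullet> x\<bar> \<le> C"
  shows "\<exists>C. \<forall>x\<in>F. \<bar>v \<bullet> x\<bar> \<le> C"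
  using assms(1)
proof (induction rule: span_induct_alt)
  case base
  then show ?case by auto
next
  case (step c s y)
  obtain C1 where C1: "\<forall>x\<in>F. \<bar>s \<bullet> x\<bar> \<le> C1" using assms(2)[OF step(1)] by blast
  obtain C2 where C2: "\<forall>x\<in>F. \<bar>y \<bullet> x\<bar> \<le> C2" using step(2) by blast
  have "\<bar>(c *\<^sub>R s + y) \<bullet> x\<bar> \<le> \<bar>c\<bar> * C1 + C2" if "x \<in> F" for x
  proof -
    have "\<bar>(c *\<^sub>R s + y) \<bullet> x\<bar> \<le> \<bar>c\<bar> * \<bar>s \<bullet> x\<bar> + \<bar>y \<bullet> x\<bar>"
      by (simp add: inner_add_left abs_mult[symmetric] abs_triangle_ineq)
    also have "\<dots> \<le> \<bar>c\<bar> * C1 + C2"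
      using C1 C2 that by (intro add_mono mult_left_mono) auto
    finally show ?thesis .
  qed
  then show ?case by blast
qed

lemma observable_imp_bounded:
  fixes A :: "real^'n^'n" and H :: "real^'n^'o"
  assumes "observable A H"
    and "\<And>k. k < CARD('n) \<Longrightarrow> bounded ((\<lambda>x. H *v (mpow A k *v x)) ` F)"
  shows "bounded F"
proof -
  let ?S = "\<Union>k\<in>{..<CARD('n)}. rows (H ** mpow A k)"
  have span_S: "span ?S = UNIV"
    using assms(1) unfolding observable_def by (simp add: dim_eq_full[symmetric])
  have row_bounded: "\<exists>C. \<forall>x\<in>F. \<bar>s \<bullet> x\<bar> \<le> C" if "s \<in> ?S" for s
  proof -
    from that obtain k q where k: "k < CARD('n)" and s: "s = (H ** mpow A k) $ q"
      by (auto simp: rows_def row_def)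
    obtain M where M: "\<And>x. x \<in> F \<Longrightarrow> norm (H *v (mpow A k *v x)) \<le> M"
      using assms(2)[OF k] by (auto simp: bounded_iff)
    have "\<bar>s \<bullet> x\<bar> \<le> M" if "x \<in> F" for x
    proof -
      have "\<bar>s \<bullet> x\<bar> = \<bar>(H *v (mpow A k *v x)) $ q\<bar>"
        by (simp add: s matrix_row_inner matrix_vector_mul_assoc)
      also have "\<dots> \<le> M"
        using component_le_norm_cart M[OF that] by (rule order_trans)
      finally show ?thesis .
    qed
    then show ?thesis by blast
  qed
  have "\<exists>c. \<forall>x\<in>F. \<bar>x $ j\<bar> \<le> c" for j
    using bounded_inner_span[of "axis j 1" ?S F, OF _ row_bounded] span_S
    by (simp add: inner_axis')
  then obtain C where C: "\<And>j x. x \<in> F \<Longrightarrow> \<bar>x $ j\<bar> \<le> C j" by metis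
  have "norm x \<le> (\<Sum>j\<in>UNIV. C j)" if "x \<in> F" for x
    using norm_le_l1_cart[of x] sum_mono[of UNIV "\<lambda>j. \<bar>x $ j\<bar>" C] C[OF that]
    by (meson order_trans)
  then show ?thesis by (auto simp: bounded_iff)
qed

lemma bounded_forced_response:
  fixes A :: "real^'n^'n" and B :: "real^'m^'n"
  assumes "bounded U"
  shows "bounded {xs i - mpow A i *v xs 0 | xs us.
                    \<forall>j<i. xs (Suc j) = A *v xs j + B *v us j \<and> us j \<in> U}"
    (is "bounded (?R i)")
proof (induction i)
  case 0
  then show ?case by simp
next
  case (Suc i)
  let ?step = "\<lambda>(d, u). A *v d + B *v u"
  have "?R (Suc i) \<subseteq> ?step ` (?R i \<times> U)"
  proof
    fix d assume "d \<in> ?R (Suc i)"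
    then obtain xs us where d: "d = xs (Suc i) - mpow A (Suc i) *v xs 0"
      and tr: "\<forall>j<Suc i. xs (Suc j) = A *v xs j + B *v us j \<and> us j \<in> U" by blast
    have "d = ?step (xs i - mpow A i *v xs 0, us i)"
      using tr by (simp add: d matrix_vector_mul_assoc matrix_vector_right_distrib
          matrix_vector_mult_diff_distrib)
    moreover have "(xs i - mpow A i *v xs 0, us i) \<in> ?R i \<times> U"
    proof -
      have "\<forall>j<i. xs (Suc j) = A *v xs j + B *v us j \<and> us j \<in> U"
        using tr by auto
      then show ?thesis using tr by blast
    qed
    ultimately show "d \<in> ?step ` (?R i \<times> U)" by blast
  qed
  moreover have "bounded (?step ` (?R i \<times> U))"
  proof (rule bounded_linear_image)
    show "bounded (?R i \<times> U)" using Suc assms by (rule bounded_Times)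
    show "bounded_linear ?step"
      by (simp add: case_prod_unfold bounded_linear_add bounded_linear_compose[OF
            matrix_vector_mul_bounded_linear] bounded_linear_fst bounded_linear_snd)
  qed
  ultimately show ?case by (rule bounded_subset[rotated])
qed

lemma bounded_lp_feasible:
  fixes A :: "real^'n^'n" and B :: "real^'m^'n" and H :: "real^'n^'o"
  assumes "observable A H" and "bounded Z" and "bounded U" and "CARD('n) - 1 \<le> ibar"
  shows "bounded (lp_feasible A B H Z U ibar)"
proof (rule observable_imp_bounded[OF assms(1)])
  fix k assume "k < CARD('n)"
  then have "k \<le> ibar" using assms(4) by linarith
  let ?R = "{xs k - mpow A k *v xs 0 | xs us.
              \<forall>j<k. xs (Suc j) = A *v xs j + B *v us j \<and> us j \<in> U}"
  have "(\<lambda>x. H *v (mpow A k *v x)) ` lp_feasible A B H Z U ibar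
          \<subseteq> (\<lambda>(z, w). z - w) ` (Z \<times> (*v) H ` ?R)"
  proof (rule image_subsetI)
    fix x assume "x \<in> lp_feasible A B H Z U ibar"
    then obtain xs us where "xs 0 = x"
      and tr: "\<forall>i<ibar. xs (Suc i) = A *v xs i + B *v us i \<and> us i \<in> U"
      and out: "\<forall>i\<le>ibar. H *v xs i \<in> Z"
      unfolding lp_feasible_def by blast
    have "\<forall>j<k. xs (Suc j) = A *v xs j + B *v us j \<and> us j \<in> U"
      using tr \<open>k \<le> ibar\<close> by auto
    then have "xs k - mpow A k *v xs 0 \<in> ?R" by blast
    moreover have "H *v xs k \<in> Z" using out \<open>k \<le> ibar\<close> by blast
    ultimately have "(H *v xs k, H *v (xs k - mpow A k *v xs 0)) \<in> Z \<times> (*v) H ` ?R"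
      by blast
    moreover have "H *v (mpow A k *v x)
        = (\<lambda>(z, w). z - w) (H *v xs k, H *v (xs k - mpow A k *v xs 0))"
      by (simp add: \<open>xs 0 = x\<close> matrix_vector_mult_diff_distrib)
    ultimately show "H *v (mpow A k *v x) \<in> (\<lambda>(z, w). z - w) ` (Z \<times> (*v) H ` ?R)"
      by (rule image_eqI[rotated])
  qed
  moreover have "bounded ((\<lambda>(z, w). z - w) ` (Z \<times> (*v) H ` ?R))"
    using assms(2) bounded_linear_image[OF bounded_forced_response[OF assms(3)]
        matrix_vector_mul_bounded_linear]
    by (rule bounded_minus)
  ultimately show "bounded ((\<lambda>x. H *v (mpow A k *v x)) ` lp_feasible A B H Z U ibar)"
    by (rule bounded_subset[rotated])
qed

lemma trajectory_in_lp_feasible: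
  assumes "\<And>k. k \<ge> k0 \<Longrightarrow> xbar (Suc k) = A *v xbar k + B *v ubar k"
    and "\<And>k. k \<ge> k0 \<Longrightarrow> ubar k \<in> U" and "\<And>k. k \<ge> k0 \<Longrightarrow> H *v xbar k \<in> Z"
    and "k \<ge> k0"
  shows "xbar k \<in> lp_feasible A B H Z U ibar"
  unfolding lp_feasible_def
  by (rule CollectI, rule exI[of _ "\<lambda>i. xbar (k + i)"], rule exI[of _ "\<lambda>i. ubar (k + i)"])
    (use assms in auto)

lemma hxbar_row_inner:
  "hxbar_row (Inl i) \<bullet> x = x $ i" "hxbar_row (Inr i) \<bullet> x = - x $ i"
  by (simp_all add: hxbar_row_def inner_axis')

lemma hxbar_polytope_eq_cbox:
  "{x. \<forall>l. hxbar_row l \<bullet> x \<le> c l} = cbox (\<chi> i. - c (Inr i)) (\<chi> i. c (Inl i))"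
  by (auto simp: mem_box_cart hxbar_row_inner split_sum_all minus_le_iff)

lemma lp_feasible_subset_Xbar:
  assumes "\<And>l. bdd_above ((\<lambda>x0. hxbar_row l \<bullet> x0) ` lp_feasible A B H Z U ibar)"
  shows "lp_feasible A B H Z U ibar \<subseteq> Xbar A B H Z U ibar"
  unfolding Xbar_def bxbar_def using assms by (auto intro: cSup_upper)

theorem proposition1:
  fixes A :: "real^'n^'n" and B :: "real^'m^'n" and C :: "real^'n^'p" and H :: "real^'n^'o"
    and Hz :: "real^'o^'qz" and bz :: "real^'qz"
    and Hu :: "real^'m^'qu" and bu :: "real^'qu"
    and xbar :: "nat \<Rightarrow> real^'n" and ubar :: "nat \<Rightarrow> real^'m"
    and k0 :: nat and ibar :: nat
  assumes ibar: "ibar \<ge> CARD('n) - 1"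
    and Zc: "compact (polytope_hrep Hz bz)" and Z0: "0 \<in> polytope_hrep Hz bz"
    and Uc: "compact (polytope_hrep Hu bu)" and U0: "0 \<in> polytope_hrep Hu bu"
    and ctrb: "controllable A B"
    and obsC: "observable A C"
    and obsH: "observable A H"
    and dyn: "\<And>k. k \<ge> k0 \<Longrightarrow> xbar (Suc k) = A *v xbar k + B *v ubar k"
    and uin: "\<And>k. k \<ge> k0 \<Longrightarrow> ubar k \<in> polytope_hrep Hu bu"
    and zin: "\<And>k. k \<ge> k0 \<Longrightarrow> H *v xbar k \<in> polytope_hrep Hz bz"
  shows "(\<forall>l. lp_feasible A B H (polytope_hrep Hz bz) (polytope_hrep Hu bu) ibar \<noteq> {}
              \<and> bdd_above ((\<lambda>x0. hxbar_row l \<bullet> x0) `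
                    lp_feasible A B H (polytope_hrep Hz bz) (polytope_hrep Hu bu) ibar))
       \<and> compact (Xbar A B H (polytope_hrep Hz bz) (polytope_hrep Hu bu) ibar)
       \<and> (\<forall>k\<ge>k0. xbar k \<in> Xbar A B H (polytope_hrep Hz bz) (polytope_hrep Hu bu) ibar)"
proof -
  let ?F = "lp_feasible A B H (polytope_hrep Hz bz) (polytope_hrep Hu bu) ibar"
  let ?X = "Xbar A B H (polytope_hrep Hz bz) (polytope_hrep Hu bu) ibar"
  have feasible: "xbar k \<in> ?F" if "k \<ge> k0" for k
    using dyn uin zin that by (rule trajectory_in_lp_feasible)
  have "bounded ?F"
    using obsH compact_imp_bounded[OF Zc] compact_imp_bounded[OF Uc] ibar
    by (rule bounded_lp_feasible)
  then have bdd: "bdd_above ((\<lambda>x0. hxbar_row l \<bullet> x0) ` ?F)" for l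
    by (intro bounded_imp_bdd_above bounded_linear_image bounded_linear_inner_right)
  have "compact ?X"
    unfolding Xbar_def hxbar_polytope_eq_cbox by (rule compact_cbox)
  moreover have "?F \<subseteq> ?X"
    using bdd by (rule lp_feasible_subset_Xbar)
  ultimately show ?thesis
    using feasible bdd by (intro conjI allI) auto
qed

end
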